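(* The following formulas hold: $$\mathrm{MARS}^+:=\bigcup_{m\in\mathbb{N}}\mathrm{MARS}_m^+=\Bigl\{\xi+\mathrm{i}\eta\in\mathbb{C} : \eta>0,\ \eta<\operatorname{arccot}\Bigl(\frac{\xi}{\eta}\Bigr)\Bigr\}=\bigl\{a\in\mathbb{C} : \operatorname{Im}(a)\in(0,\pi),\ \operatorname{Im}(e^a\overline{a})<0\bigr\},$$ $$\mathrm{MARS}=\bigl\{\xi+\mathrm{i}\eta : \xi<\eta\cot(\eta),\ \xi\in\mathbb{R},\ \eta\in(-\pi,0)\cup(0,\pi)\bigr\}\cup(-\infty,1).$$
   Context: $\mathbb{N}=\{1,2,\dots\}$; $\xi,\eta$ denote real numbers. $\operatorname{arccot}$ denotes the continuous decreasing branch $\mathbb{R}\to(0,\pi)$ of the inverse cotangent. For $m\in\mathbb{N}$ and $a\in\mathbb{C}$, $\mathcal{M}_m(a)\in\mathbb{C}^{m\times m}$ is the matrix whose $i$-th row, for $1\le i\le m-1$, has entry $1$ in column $i+1$ and zeros elsewhere, and whose last row has all entries equal to $\frac{a}{m}$. $\sigma(\cdot)$ denotes the spectrum and $B_1(0)=\{z\in\mathbb{C}:|z|<1\}$. $\mathrm{MARS}_m:=\{a\in\mathbb{C}:\sigma(\mathcal{M}_m(a))\subseteq B_1(0)\}$, $\mathrm{MARS}:=\bigcup_{m\in\mathbb{N}}\mathrm{MARS}_m$, and $\mathrm{MARS}_m^+:=\{a\in\mathrm{MARS}_m:\operatorname{Im}(a)>0\}$. *)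

theory Defs
  imports "HOL-Analysis.Analysis" "Jordan_Normal_Form.Spectral_Radius"
begin

definition arccot :: "real \<Rightarrow> real" where
  "arccot x = (THE y. 0 < y \<and> y < pi \<and> cot y = x)"

lemma cot_pi_half_minus_arctan: "cot (pi / 2 - arctan x) = x"
proof -
  have "cot (pi / 2 - arctan x) = tan (arctan x)"
    by (simp add: cot_def tan_def cos_diff sin_diff)
  then show ?thesis by (simp only: tan_arctan)
qed

lemma arccot_eq: "arccot x = pi / 2 - arctan x"
  unfolding arccot_def
proof (rule the_equality)
  show "0 < pi / 2 - arctan x \<and> pi / 2 - arctan x < pi \<and> cot (pi / 2 - arctan x) = x"
    using arctan_lbound [of x] arctan_ubound [of x] cot_pi_half_minus_arctan [of x] by linarith
next
  fix y assume y: "0 < y \<and> y < pi \<and> cot y = x"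
  have "tan (pi / 2 - y) = x"
    using y by (simp add: tan_def cot_def cos_diff sin_diff)
  then have "arctan x = pi / 2 - y"
    using y by (intro arctan_unique) auto
  then show "y = pi / 2 - arctan x" by simp
qed

lemma arccot_bounds: "0 < arccot x" "arccot x < pi"
  using arctan_lbound [of x] arctan_ubound [of x] unfolding arccot_eq by linarith+

lemma cot_arccot: "cot (arccot x) = x"
  by (simp only: arccot_eq cot_pi_half_minus_arctan)

lemma arccot_strict_antimono: "x < y \<Longrightarrow> arccot y < arccot x"
  by (simp add: arccot_eq arctan_less_iff)

lemma continuous_on_arccot: "continuous_on UNIV arccot"
  unfolding arccot_eq by (intro continuous_intros)

(* Rows and columns of the matrix are indexed from 0, so its last row has index m - 1. *)
definition M_mat :: "nat \<Rightarrow> complex \<Rightarrow> complex Matrix.mat" where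
  "M_mat m a = Matrix.mat m m (\<lambda>(i, j).
     if i = m - 1 then a / of_nat m
     else if j = i + 1 then 1 else 0)"

definition MARS_at :: "nat \<Rightarrow> complex set" where
  "MARS_at m = {a. spectrum (M_mat m a) \<subseteq> ball 0 1}"

(* The unions start at m = 1: the empty matrix would put every a into MARS_at 0. *)
definition MARS :: "complex set" where
  "MARS = (\<Union>m\<in>{1..}. MARS_at m)"

definition MARS_at_plus :: "nat \<Rightarrow> complex set" where
  "MARS_at_plus m = {a \<in> MARS_at m. 0 < Im a}"

definition MARS_plus :: "complex set" where
  "MARS_plus = (\<Union>m\<in>{1..}. MARS_at_plus m)"

end

theory Submission
  imports Defs "HOL-Complex_Analysis.Conformal_Mappings"
begin

text \<open>
  Write \<open>g\<^sub>m(z) = (z + z\<^sup>2 + \<dots> + z\<^sup>m) / m\<close>. Inverting the eigenvalues turns membership of \<open>a\<close>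
  in the \<open>m\<close>-th set into the condition that \<open>a g\<^sub>m(z) \<noteq> 1\<close> on the closed unit disc. The image of that
  disc under \<open>g\<^sub>m\<close> is star-shaped about \<open>0\<close>: at a point \<open>z\<close> of the unit circle,
  \<open>Re (z g\<^sub>m'(z) / g\<^sub>m(z)) = (m + 1) / 2 > 0\<close>, so shrinking the value \<open>g\<^sub>m(z)\<close> radially moves the
  preimage into the disc. Hence along each ray only the values on the unit circle matter, where
  \<open>m sin x \<sqdot> g\<^sub>m(exp (- 2 i x)) = sin (m x) exp (- i (m + 1) x)\<close>. For \<open>a = t exp (i \<phi>)\<close> the choice
  \<open>x = \<phi> / (m + 1)\<close> excludes \<open>a\<close> for every \<open>m\<close> as soon as \<open>t sin \<phi> \<ge> \<phi>\<close>; conversely every relevant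
  \<open>x\<close> satisfies \<open>(m + 1) |x| \<ge> \<phi>\<close> and tends to \<open>0\<close> as \<open>m\<close> grows, which is incompatible with
  \<open>t sin \<phi> < \<phi>\<close>. The condition \<open>t sin \<phi> < \<phi>\<close> says \<open>Im a < Arg a\<close>.
\<close>

section \<open>The spectral condition as an equation for power averages\<close>

definition power_average :: "nat \<Rightarrow> complex \<Rightarrow> complex" where
  "power_average m z = (\<Sum>j=1..m. z ^ j) / of_nat m"

lemma M_mat_mult_vec_nth:
  assumes "m \<ge> 1" "v \<in> carrier_vec m" "i < m"
  shows "vec_index (M_mat m a *\<^sub>v v) i =
    (if i = m - 1 then a / of_nat m * (\<Sum>j<m. vec_index v j) else vec_index v (i + 1))"
proof -
  have "vec_index (M_mat m a *\<^sub>v v) i = (\<Sum>j<m. M_mat m a $$ (i, j) * vec_index v j)"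
    using assms by (simp add: M_mat_def scalar_prod_def atLeast0LessThan)
  also have "\<dots> = (\<Sum>j<m. if i = m - 1 then a / of_nat m * vec_index v j
                          else if j = i + 1 then vec_index v j else 0)"
    using assms by (intro sum.cong) (auto simp: M_mat_def)
  also have "\<dots> = (if i = m - 1 then a / of_nat m * (\<Sum>j<m. vec_index v j) else vec_index v (i + 1))"
    using assms by (auto simp: sum_distrib_left sum.delta)
  finally show ?thesis .
qed

text \<open>The shift rows force an eigenvector for k to be a nonzero multiple of (1, k, ...,
  k^(m-1)), and the last row then gives the equation. Conversely the vector of powers is an
  eigenvector.\<close>

lemma eigenvalue_M_mat:
  assumes "m \<ge> 1"
  shows "eigenvalue (M_mat m a) k \<longleftrightarrow> k ^ m = a / of_nat m * (\<Sum>j<m. k ^ j)"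
proof
  assume "eigenvalue (M_mat m a) k"
  then obtain v where v: "v \<in> carrier_vec m" "v \<noteq> 0\<^sub>v m" "M_mat m a *\<^sub>v v = k \<cdot>\<^sub>v v"
    by (auto simp: eigenvalue_def eigenvector_def M_mat_def)
  have entry: "k * vec_index v i =
      (if i = m - 1 then a / of_nat m * (\<Sum>j<m. vec_index v j) else vec_index v (i + 1))" if "i < m" for i
    using M_mat_mult_vec_nth [OF assms v(1) that, of a] v(1,3) that by simp
  have pow: "vec_index v i = k ^ i * vec_index v 0" if "i < m" for i
    using that
  proof (induction i)
    case (Suc i)
    then have "vec_index v (Suc i) = k * vec_index v i" using entry [of i] by (auto split: if_splits)
    with Suc show ?case by simp
  qed simp
  have "vec_index v 0 \<noteq> 0"
  proof
    assume "vec_index v 0 = 0"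
    then have "v = 0\<^sub>v m" using v(1) pow by (intro eq_vecI) auto
    with v(2) show False by simp
  qed
  have "k ^ m * vec_index v 0 = k * vec_index v (m - 1)"
    using assms pow [of "m - 1"] by (cases m) auto
  also have "\<dots> = a / of_nat m * (\<Sum>j<m. k ^ j * vec_index v 0)"
    using entry [of "m - 1"] assms sum.cong [OF refl pow, of "{..<m}" "\<lambda>j. j"] by simp
  finally have "k ^ m * vec_index v 0 = a / of_nat m * (\<Sum>j<m. k ^ j) * vec_index v 0"
    by (simp add: sum_distrib_right)
  with \<open>vec_index v 0 \<noteq> 0\<close> show "k ^ m = a / of_nat m * (\<Sum>j<m. k ^ j)"
    by (simp only: mult_right_cancel simp_thms)
next
  assume k: "k ^ m = a / of_nat m * (\<Sum>j<m. k ^ j)"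
  define v where "v = Matrix.vec m (\<lambda>i. k ^ i)"
  have car: "v \<in> carrier_vec m" by (simp add: v_def)
  have "vec_index v 0 \<noteq> vec_index (0\<^sub>v m) 0" using assms by (simp add: v_def)
  then have nz: "v \<noteq> 0\<^sub>v m" by metis
  have "M_mat m a *\<^sub>v v = k \<cdot>\<^sub>v v"
  proof (rule eq_vecI)
    fix i assume "i < dim_vec (k \<cdot>\<^sub>v v)"
    then have i: "i < m" by (simp add: v_def)
    have last: "k ^ m = k * k ^ (m - 1)" using assms by (cases m) auto
    show "vec_index (M_mat m a *\<^sub>v v) i = vec_index (k \<cdot>\<^sub>v v) i"
      unfolding M_mat_mult_vec_nth [OF assms car i] using i k last by (auto simp: v_def)
  qed (simp add: v_def M_mat_def)
  with car nz show "eigenvalue (M_mat m a) k"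
    by (auto simp: eigenvalue_def eigenvector_def M_mat_def)
qed

text \<open>Dividing the equation for an eigenvalue k by k^m and putting z = 1/k gives a g(z) = 1,
  where g is \<open>power_average m\<close>. The range |k| \<ge> 1 becomes 0 < |z| \<le> 1, and z =
  0 adds no condition because g(0) = 0.\<close>

lemma mem_MARS_at_iff:
  assumes "m \<ge> 1"
  shows "a \<in> MARS_at m \<longleftrightarrow> (\<forall>z. norm z \<le> 1 \<longrightarrow> a * power_average m z \<noteq> 1)"
proof -
  have rev: "k ^ m = a / of_nat m * (\<Sum>j<m. k ^ j) \<longleftrightarrow> a * power_average m (inverse k) = 1"
    if "k \<noteq> 0" for k :: complex
  proof -
    have "(\<Sum>j<m. k ^ j) = (\<Sum>j=1..m. k ^ (m - j))"
      by (rule sum.reindex_bij_witness [of _ "\<lambda>j. m - j" "\<lambda>j. m - j"]) auto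
    also have "\<dots> = k ^ m * (\<Sum>j=1..m. inverse k ^ j)"
      using that by (simp add: sum_distrib_left power_diff power_inverse divide_inverse)
    finally have "a / of_nat m * (\<Sum>j<m. k ^ j) = k ^ m * (a * power_average m (inverse k))"
      by (simp add: power_average_def)
    with that show ?thesis by auto
  qed
  have "power_average m 0 = 0" by (auto simp: power_average_def intro!: sum.neutral)
  then have nz: "z \<noteq> 0" if "a * power_average m z = 1" for z using that by auto
  have "a \<in> MARS_at m \<longleftrightarrow> (\<forall>k. norm k \<ge> 1 \<longrightarrow> \<not> eigenvalue (M_mat m a) k)"
    by (auto simp: MARS_at_def spectrum_def subset_iff not_le)
  also have "\<dots> \<longleftrightarrow> (\<forall>k. norm k \<ge> 1 \<longrightarrow> a * power_average m (inverse k) \<noteq> 1)"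
    unfolding eigenvalue_M_mat [OF assms] using rev by (metis norm_zero not_one_le_zero)
  also have "\<dots> \<longleftrightarrow> (\<forall>z. norm z \<le> 1 \<longrightarrow> a * power_average m z \<noteq> 1)"
  proof safe
    fix z :: complex
    assume "\<forall>k. norm k \<ge> 1 \<longrightarrow> a * power_average m (inverse k) \<noteq> 1" "norm z \<le> 1"
      "a * power_average m z = 1"
    then show False
      using nz [of z] by (auto simp: norm_inverse one_le_inverse dest: spec [of _ "inverse z"])
  next
    fix k :: complex
    assume "\<forall>z. norm z \<le> 1 \<longrightarrow> a * power_average m z \<noteq> 1" "norm k \<ge> 1"
      "a * power_average m (inverse k) = 1"
    then show False by (auto simp: norm_inverse inverse_le_1_iff dest: spec [of _ "inverse k"])
  qed
  finally show ?thesis .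
qed

section \<open>Closed form, bounds and regularity of power averages\<close>

lemma power_average_geometric:
  assumes "m \<ge> 1"
  shows "of_nat m * (1 - z) * power_average m z = z * (1 - z ^ m)"
proof -
  have "(\<Sum>j=1..m. z ^ j) = (\<Sum>j<m. z * z ^ j)"
    by (rule sum.reindex_bij_witness [of _ Suc "\<lambda>j. j - 1"]) (auto simp: power_eq_if)
  then have "(1 - z) * (\<Sum>j=1..m. z ^ j) = z * ((1 - z) * (\<Sum>j<m. z ^ j))"
    by (simp add: sum_distrib_left mult.left_commute)
  with assms show ?thesis by (simp add: power_average_def one_diff_power_eq)
qed

lemma power_average_1: "m \<ge> 1 \<Longrightarrow> power_average m 1 = 1"
  by (simp add: power_average_def)

lemma norm_power_average_le:
  assumes "norm z \<le> 1"
  shows "norm (power_average m z) \<le> 1"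
proof -
  have "norm (\<Sum>j=1..m. z ^ j) \<le> (\<Sum>j=1..m. 1)"
    using assms by (intro sum_norm_le) (simp add: norm_power power_le_one)
  then show ?thesis by (cases "m = 0") (auto simp: power_average_def norm_divide)
qed

lemma has_field_derivative_power_average:
  "(power_average m has_field_derivative (\<Sum>j=1..m. of_nat j * z ^ (j - 1)) / of_nat m) (at z)"
  unfolding power_average_def [abs_def] divide_inverse by (auto intro!: derivative_eq_intros)

lemma power_average_holomorphic: "power_average m holomorphic_on S"
  unfolding power_average_def [abs_def] divide_inverse by (intro holomorphic_intros)

lemma cnj_power_average: "cnj (power_average m z) = power_average m (cnj z)"
  by (simp add: power_average_def)

section \<open>The logarithmic derivative on the unit circle\<close>

text \<open>On the circle |1 - z|^2 = 2 (1 - Re z), while the real part in question is (1 - Re z) /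
  |1 - z|^2.\<close>

lemma Re_inverse_one_minus:
  fixes z :: complex
  assumes "norm z = 1" "z \<noteq> 1"
  shows "Re (1 / (1 - z)) = 1 / 2"
proof -
  have sq: "(Re z)\<^sup>2 + (Im z)\<^sup>2 = 1" using assms by (simp add: cmod_power2 [symmetric])
  have "Re z \<noteq> 1"
    using sq assms(2) by (auto simp: complex_eq_iff)
  then show ?thesis
    using sq by (simp add: Re_divide field_simps power2_eq_square)
qed

text \<open>Differentiating m (1 - z) g(z) = z (1 - z^m) gives z g'/g = m - m/(1 - z^m) + 1/(1 - z),
  and both fractions 1/(1 - z^m) and 1/(1 - z) have real part 1/2. This expression is singular at z
  = 1, where g'(1) is computed as the mean of 1, ..., m.\<close>

lemma Re_logderiv_power_average:
  assumes "m \<ge> 1" "norm z = 1" "power_average m z \<noteq> 0"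
  shows "Re (z * deriv (power_average m) z / power_average m z) = (real m + 1) / 2"
proof (cases "z = 1")
  case True
  have "(\<Sum>j=1..m. of_nat j :: complex) = of_nat (m * (m + 1) div 2)"
    unfolding of_nat_sum [symmetric] using gauss_sum_nat [of m] by (simp add: atLeast0AtMost [symmetric] sum.atLeast_Suc_atMost)
  also have "\<dots> = of_real (real m * (real m + 1) / 2)"
    by (subst of_real_of_nat_eq [symmetric], subst real_of_nat_div) (auto simp: algebra_simps)
  finally have "(\<Sum>j=1..m. of_nat j :: complex) / of_nat m = of_real ((real m + 1) / 2)"
    using assms(1) by simp
  moreover have "deriv (power_average m) 1 = (\<Sum>j=1..m. of_nat j :: complex) / of_nat m"
    using DERIV_imp_deriv [OF has_field_derivative_power_average [of m 1]] by simp
  ultimately have "deriv (power_average m) 1 = of_real ((real m + 1) / 2)" by (rule trans [rotated])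
  then show ?thesis
    unfolding True power_average_1 [OF assms(1)]
    by (simp only: mult_1 div_by_1 Re_complex_of_real)
next
  case False
  let ?g = "power_average m z"
  let ?D = "deriv (power_average m) z"
  have D: "(power_average m has_field_derivative ?D) (at z)"
    using has_field_derivative_power_average DERIV_imp_deriv by metis
  have z: "z \<noteq> 0" using assms by auto
  have g: "of_nat m * (1 - z) * ?g = z * (1 - z ^ m)"
    by (rule power_average_geometric [OF assms(1)])
  \<comment> \<open>With z different from 1, \<open>z ^ m = 1\<close> would make g vanish at
    z.\<close>
  then have zm: "z ^ m \<noteq> 1" using assms False by auto
  have D1: "((\<lambda>z. of_nat m * (1 - z) * power_average m z) has_field_derivative
      of_nat m * (- ?g + (1 - z) * ?D)) (at z)"
    by (rule derivative_eq_intros D refl)+ (simp add: algebra_simps)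
  have D2: "((\<lambda>z. z - z ^ Suc m) has_field_derivative 1 - of_nat (Suc m) * z ^ m) (at z)"
    by (rule derivative_eq_intros refl)+ simp
  have "(\<lambda>z. of_nat m * (1 - z) * power_average m z) = (\<lambda>z. z - z ^ Suc m)"
    by (rule ext, subst power_average_geometric [OF assms(1)]) (simp add: right_diff_distrib)
  from DERIV_unique [OF D1 [unfolded this] D2]
  have "of_nat m * (- ?g + (1 - z) * ?D) = 1 - (of_nat m + 1) * z ^ m" by (simp add: add.commute)
  moreover have "z * (of_nat m * (1 - z) * ?D)
      = z * (of_nat m * (- ?g + (1 - z) * ?D)) + z * (of_nat m * ?g)"
    by (simp add: algebra_simps)
  ultimately have h: "z * (of_nat m * (1 - z) * ?D)
      = z * (1 - (of_nat m + 1) * z ^ m) + z * (of_nat m * ?g)"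
    by (simp only:)
  have "z * ?D / ?g
      = (z * (1 - (of_nat m + 1) * z ^ m) + z * (of_nat m * ?g)) / (of_nat m * (1 - z) * ?g)"
    unfolding h [symmetric] using assms False by simp
  also have "\<dots> = z * (1 - (of_nat m + 1) * z ^ m) / (z * (1 - z ^ m)) + z / (1 - z)"
    using assms False unfolding add_divide_distrib g by (simp add: g [symmetric])
  also have "\<dots> = of_nat m + 1 - of_nat m * (1 / (1 - z ^ m)) + (1 / (1 - z) - 1)"
  proof -
    have "(1 - (of_nat m + 1) * z ^ m) / (1 - z ^ m) = of_nat m + 1 - of_nat m * (1 / (1 - z ^ m))"
      using zm by (simp add: field_simps)
    moreover have "z / (1 - z) = 1 / (1 - z) - 1" using False by (simp add: field_simps)
    ultimately show ?thesis using z by simp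
  qed
  finally have eq: "z * ?D / ?g = of_nat m - of_nat m * (1 / (1 - z ^ m)) + 1 / (1 - z)"
    by simp
  have "Re (1 / (1 - z ^ m)) = 1 / 2" "Re (1 / (1 - z)) = 1 / 2"
    using assms(2) False zm by (simp_all only: Re_inverse_one_minus norm_power power_one not_False_eq_True)
  moreover have "Re (of_nat m * w) = real m * Re w" for w by simp
  ultimately show ?thesis
    unfolding eq by (simp only: plus_complex.sel minus_complex.sel complex_Re_of_nat) simp
qed

section \<open>Radial structure of the image of the disc\<close>

lemma open_power_average_image:
  assumes "m \<ge> 1"
  shows "open (power_average m ` ball 0 1)"
proof (rule open_mapping_thm)
  have "power_average m 0 = 0" by (auto simp: power_average_def intro!: sum.neutral)
  with power_average_1 [OF assms] show "\<not> power_average m constant_on UNIV"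
    by (metis UNIV_I constant_on_def zero_neq_one)
qed (auto simp: power_average_holomorphic)

text \<open>Values taken inside the disc can be moved radially both ways, since the image of the
  open disc is open.\<close>

lemma power_average_scale_interior:
  assumes "m \<ge> 1" "norm z < 1"
  obtains e where "e > 0" "\<And>r. \<bar>r - 1\<bar> < e \<Longrightarrow>
    \<exists>z'. norm z' < 1 \<and> power_average m z' = of_real r * power_average m z"
proof -
  obtain e where e: "e > 0" "ball (power_average m z) e \<subseteq> power_average m ` ball 0 1"
    using open_power_average_image [OF assms(1)] assms(2) by (force simp: open_contains_ball)
  show ?thesis
  proof
    fix r :: real assume r: "\<bar>r - 1\<bar> < e"
    have "power_average m z - of_real r * power_average m z
        = of_real (1 - r) * power_average m z" by (simp add: algebra_simps)
    then have "dist (power_average m z) (of_real r * power_average m z)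
        = \<bar>r - 1\<bar> * norm (power_average m z)"
      unfolding dist_norm by (simp only: norm_mult norm_of_real abs_minus_commute)
    \<comment> \<open>As |g(z)| \<le> 1, the radius of the ball serves directly as the bound for |r
      - 1|.\<close>
    also have "\<dots> \<le> \<bar>r - 1\<bar>"
      using norm_power_average_le [of z m] assms(2) by (intro mult_left_le) auto
    finally have "of_real r * power_average m z \<in> power_average m ` ball 0 1"
      using e r by (intro subsetD [OF e(2)]) simp
    then show "\<exists>z'. norm z' < 1 \<and> power_average m z' = of_real r * power_average m z"
      by fastforce
  qed (rule e)
qed

text \<open>Let f be the local inverse of g at w = g(z), and Q = z g'(z)/g(z). The derivative of
  |f(t w)|^2 at t = 1 is 2 Re (1/Q) > 0, so lowering t below 1 pulls the preimage strictly into the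
  disc.\<close>

lemma power_average_shrink_boundary:
  assumes "m \<ge> 1" "norm z = 1" "power_average m z \<noteq> 0"
  obtains e where "e > 0" "\<And>h. 0 < h \<Longrightarrow> h < e \<Longrightarrow>
    \<exists>z'. norm z' < 1 \<and> power_average m z' = of_real (1 - h) * power_average m z"
proof -
  let ?g = "power_average m"
  define w where "w = ?g z"
  define Q where "Q = z * deriv ?g z / w"
  have "Re Q > 0"
    using Re_logderiv_power_average [OF assms] by (simp add: Q_def w_def)
  then have D: "deriv ?g z \<noteq> 0" by (auto simp: Q_def)
  have "Q \<noteq> 0" using \<open>Re Q > 0\<close> by auto
  with \<open>Re Q > 0\<close> have ReQ: "Re (1 / Q) > 0"
    by (simp add: Re_divide complex_neq_0)
  obtain r where r: "r > 0" "open (?g ` ball z r)" "inj_on ?g (ball z r)"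
    using has_complex_derivative_locally_invertible [OF power_average_holomorphic UNIV_I open_UNIV D]
    by metis
  obtain f where f: "f holomorphic_on ?g ` ball z r"
      "\<And>y. y \<in> ball z r \<Longrightarrow> deriv ?g y * deriv f (?g y) = 1"
      "\<And>y. y \<in> ball z r \<Longrightarrow> f (?g y) = y"
    using holomorphic_has_inverse [OF power_average_holomorphic open_ball r(3)] by metis
  have w: "w \<in> ?g ` ball z r" using r(1) by (auto simp: w_def)
  have fw: "f w = z" using f(3) [of z] r(1) by (simp add: w_def)
  have "(f has_field_derivative deriv f w) (at w)"
    using holomorphic_derivI [OF f(1) r(2) w] .
  moreover have "deriv f w = 1 / deriv ?g z"
    using f(2) [of z] r(1) D by (simp add: w_def field_simps)
  ultimately have "(f has_field_derivative 1 / deriv ?g z) (at (of_real 1 * w))"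
    by simp
  moreover have "((\<lambda>t. of_real t * w) has_vector_derivative w) (at 1)"
    by (auto intro!: derivative_eq_intros)
  ultimately have "((f \<circ> (\<lambda>t. of_real t * w)) has_vector_derivative (w * (1 / deriv ?g z))) (at 1)"
    using field_vector_diff_chain_at by blast
  then have F: "((\<lambda>t. f (of_real t * w)) has_derivative (\<lambda>t. t *\<^sub>R (w / deriv ?g z))) (at 1)"
    by (simp add: has_vector_derivative_def o_def)
  have "((\<lambda>t. f (of_real t * w) \<bullet> f (of_real t * w)) has_real_derivative
      2 * (z \<bullet> (w / deriv ?g z))) (at 1)"
    unfolding has_field_derivative_def
    by (rule has_derivative_eq_rhs [OF has_derivative_inner [OF F F]])
      (auto simp: fun_eq_iff fw inner_commute)
  moreover have "z \<bullet> (w / deriv ?g z) > 0"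
  proof -
    \<comment> \<open>On the circle \<open>cnj z\<close> is 1/z, which identifies the inner product
      with Re (1/Q).\<close>
    have "z * cnj z = 1" using assms(2) by (simp add: complex_norm_square [symmetric])
    then have "cnj z = 1 / z" using assms(2) by (metis nonzero_eq_divide_eq mult.commute norm_zero zero_neq_one)
    then have "cnj z * (w / deriv ?g z) = 1 / Q" by (simp add: Q_def)
    moreover have "z \<bullet> u = Re (cnj z * u)" for u by (simp add: inner_complex_def)
    ultimately show ?thesis using ReQ by (simp only:)
  qed
  ultimately obtain d where d: "d > 0" "\<forall>h>0. h < d \<longrightarrow>
      f (of_real (1 - h) * w) \<bullet> f (of_real (1 - h) * w) < f (of_real 1 * w) \<bullet> f (of_real 1 * w)"
    using DERIV_pos_inc_left by (metis (no_types, lifting) mult_pos_pos zero_less_numeral)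
  obtain e where e: "e > 0" "ball w e \<subseteq> ?g ` ball z r"
    using r(2) w by (auto simp: open_contains_ball)
  show ?thesis
  proof
    \<comment> \<open>The bound d makes the norm drop; the bound e keeps the shrunk value in the
      domain of the local inverse.\<close>
    show "min d e > 0" using d e by simp
    fix h :: real assume h: "0 < h" "h < min d e"
    have "w - of_real (1 - h) * w = of_real h * w" by (simp add: algebra_simps)
    then have "dist w (of_real (1 - h) * w) = h * norm w"
      using h unfolding dist_norm by (simp only: norm_mult norm_of_real)
    also have "\<dots> \<le> h"
      using norm_power_average_le [of z m] assms(2) h by (intro mult_left_le) (auto simp: w_def)
    finally have "of_real (1 - h) * w \<in> ?g ` ball z r"
      using e h by (intro subsetD [OF e(2)]) simp
    then have "?g (f (of_real (1 - h) * w)) = of_real (1 - h) * w" using f(3) by force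
    moreover have "norm (f (of_real (1 - h) * w)) < 1"
    proof -
      have "f (of_real (1 - h) * w) \<bullet> f (of_real (1 - h) * w) < z \<bullet> z"
        using d(2) h fw by simp
      with assms(2) show ?thesis by (simp add: norm_eq_sqrt_inner)
    qed
    ultimately show "\<exists>z'. norm z' < 1 \<and> ?g z' = of_real (1 - h) * ?g z"
      unfolding w_def [symmetric] by blast
  qed
qed

text \<open>Closedness ensures that extreme radial factors are attained in the two arguments
  below.\<close>

lemma closed_scale_power_average_image:
  "closed {r :: real. of_real r * w \<in> power_average m ` cball 0 1}"
proof -
  have "compact (power_average m ` cball 0 1)"
    by (intro compact_continuous_image holomorphic_on_imp_continuous_on power_average_holomorphic) simp
  then have "closed ((\<lambda>r :: real. of_real r * w) -` (power_average m ` cball 0 1))"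
    by (intro continuous_closed_vimage compact_imp_closed continuous_intros)
  then show ?thesis by (simp add: vimage_def)
qed

text \<open>The least factor r in [s, 1] for which r g(z) is still a value on the closed disc must
  be s: otherwise its preimage, inside the disc or on the circle, admits a further small
  shrinking.\<close>

lemma power_average_starlike:
  assumes "m \<ge> 1" "norm z \<le> 1" "0 < s" "s \<le> 1"
  obtains z' where "norm z' \<le> 1" "power_average m z' = of_real s * power_average m z"
proof (cases "power_average m z = 0")
  case True
  with assms that show ?thesis by auto
next
  case False
  let ?g = "power_average m"
  define S where "S = {s..1} \<inter> {r. of_real r * ?g z \<in> ?g ` cball 0 1}"
  have "compact S"
    unfolding S_def by (intro compact_Int_closed closed_scale_power_average_image) simp
  moreover have "1 \<in> S" using assms by (auto simp: S_def)
  ultimately obtain r where r: "r \<in> S" "\<And>q. q \<in> S \<Longrightarrow> r \<le> q"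
    using compact_attains_inf [of S] by blast
  obtain y where y: "norm y \<le> 1" "?g y = of_real r * ?g z"
    using r(1) by (force simp: S_def)
  have bounds: "s \<le> r" "r \<le> 1" using r(1) by (auto simp: S_def)
  have "r = s"
  proof (rule ccontr)
    assume "r \<noteq> s"
    with bounds have "s < r" by simp
    obtain e where e: "e > 0" "\<And>h. 0 < h \<Longrightarrow> h < e \<Longrightarrow>
        \<exists>z'. norm z' < 1 \<and> ?g z' = of_real (1 - h) * ?g y"
    proof (cases "norm y < 1")
      case True
      then obtain e where e: "e > 0" "\<And>r. \<bar>r - 1\<bar> < e \<Longrightarrow>
          \<exists>z'. norm z' < 1 \<and> ?g z' = of_real r * ?g y"
        using power_average_scale_interior [OF assms(1)] by blast
      then have "\<exists>z'. norm z' < 1 \<and> ?g z' = of_real (1 - h) * ?g y" if "0 < h" "h < e" for h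
        using that \<open>e > 0\<close> e(2) [of "1 - h"] by simp
      with \<open>e > 0\<close> show ?thesis by (rule that)
    next
      case no: False
      have "?g y \<noteq> 0" using y(2) False bounds assms(3) by simp
      moreover have "norm y = 1" using no y(1) by simp
      ultimately show ?thesis
        using that power_average_shrink_boundary [OF assms(1)] by metis
    qed
    \<comment> \<open>The cap 1 - s/r keeps the new factor (1 - h) r at least s, hence in
      \<open>S\<close>.\<close>
    define h where "h = min (e / 2) (1 - s / r)"
    have h: "0 < h" "h < e" "h \<le> 1 - s / r"
      using e(1) \<open>s < r\<close> assms(3) by (auto simp: h_def)
    then obtain z' where z': "norm z' < 1" "?g z' = of_real (1 - h) * ?g y" using e(2) by blast
    have "s / r * r \<le> (1 - h) * r"
      using h(3) \<open>s < r\<close> assms(3) by (intro mult_right_mono) auto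
    then have "s \<le> (1 - h) * r" using \<open>s < r\<close> assms(3) by simp
    moreover have less: "(1 - h) * r < r" using h(1) \<open>s < r\<close> assms(3) by (simp add: algebra_simps)
    moreover have "of_real ((1 - h) * r) * ?g z = ?g z'" using z'(2) y(2) by simp
    ultimately have "(1 - h) * r \<in> S"
      using z'(1) bounds unfolding S_def by (auto intro!: image_eqI [of _ _ z'])
    with r(2) less show False by force
  qed
  with y that show ?thesis by blast
qed

text \<open>The largest factor r \<ge> 1 for which r g(z) is a value on the closed disc exists
  because g is bounded there. Its preimage cannot be interior, since openness would then allow a
  larger factor.\<close>

lemma power_average_reaches_circle:
  assumes "m \<ge> 1" "norm z \<le> 1" "power_average m z \<noteq> 0"
  obtains z' r where "norm z' = 1" "r \<ge> 1" "power_average m z' = of_real r * power_average m z"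
proof -
  let ?g = "power_average m"
  define S where "S = {1..} \<inter> {r. of_real r * ?g z \<in> ?g ` cball 0 1}"
  have "r \<le> 1 / norm (?g z)" if "r \<in> S" for r
  proof -
    have "norm (of_real r * ?g z) \<le> 1"
      using that norm_power_average_le by (auto simp: S_def)
    then show ?thesis using assms(3) that by (simp add: norm_mult S_def field_simps)
  qed
  then have "S \<subseteq> {1..1 / norm (?g z)}" by (auto simp: S_def)
  then have "compact S"
    unfolding compact_eq_bounded_closed
    using bounded_subset [OF bounded_closed_interval] closed_scale_power_average_image [of "?g z" m]
    by (auto simp: S_def intro!: closed_Int)
  moreover have "1 \<in> S" using assms by (auto simp: S_def)
  ultimately obtain r where r: "r \<in> S" "\<And>q. q \<in> S \<Longrightarrow> q \<le> r"
    using compact_attains_sup [of S] by blast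
  have "r \<ge> 1" using r(1) by (simp add: S_def)
  obtain y where y: "norm y \<le> 1" "?g y = of_real r * ?g z"
    using r(1) by (force simp: S_def)
  have "\<not> norm y < 1"
  proof
    assume "norm y < 1"
    then obtain e where e: "e > 0" "\<And>r. \<bar>r - 1\<bar> < e \<Longrightarrow>
        \<exists>z'. norm z' < 1 \<and> ?g z' = of_real r * ?g y"
      using power_average_scale_interior [OF assms(1)] by blast
    obtain z' where z': "norm z' < 1" "?g z' = of_real (1 + e / 2) * ?g y"
      using e(2) [of "1 + e / 2"] e(1) by auto
    have "of_real ((1 + e / 2) * r) * ?g z = ?g z'" using z'(2) y(2) by simp
    moreover have less: "r < (1 + e / 2) * r" using e(1) \<open>r \<ge> 1\<close> by (simp add: algebra_simps)
    moreover have "1 \<le> (1 + e / 2) * r" using less \<open>r \<ge> 1\<close> by linarith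
    ultimately have "(1 + e / 2) * r \<in> S"
      using z'(1) unfolding S_def by (auto intro!: image_eqI [of _ _ z'])
    with r(2) less show False by force
  qed
  with y \<open>r \<ge> 1\<close> that show ?thesis by force
qed

section \<open>Values on the unit circle and trigonometric estimates\<close>

text \<open>Both differences in the geometric sum formula factor by 1 - exp(-2iy) = 2i sin y
  exp(-iy). Keeping sin x as a factor on the left covers x = 0 as well.\<close>

lemma power_average_cis:
  assumes "m \<ge> 1"
  shows "of_real (real m * sin x) * power_average m (cis (- 2 * x)) =
    of_real (sin (real m * x)) * cis (- ((real m + 1) * x))"
proof -
  have one_minus: "1 - cis (- 2 * y) = 2 * \<i> * of_real (sin y) * cis (- y)" for y
    using sin_double [of y] cos_double_sin [of y]
    by (auto simp: complex_eq_iff power2_eq_square)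
  have "cis (- 2 * x) ^ m = cis (- 2 * (real m * x))"
    by (simp add: Complex.DeMoivre mult.left_commute)
  then have "of_nat m * (2 * \<i> * of_real (sin x) * cis (- x)) * power_average m (cis (- 2 * x))
      = cis (- 2 * x) * (2 * \<i> * of_real (sin (real m * x)) * cis (- (real m * x)))"
    using power_average_geometric [OF assms, of "cis (- 2 * x)"] by (simp only: one_minus)
  also have "\<dots> = 2 * \<i> * cis (- x) * (of_real (sin (real m * x)) * (cis (- x) * cis (- (real m * x))))"
    by (simp add: cis_mult)
  also have "cis (- x) * cis (- (real m * x)) = cis (- ((real m + 1) * x))"
    by (simp add: cis_mult algebra_simps)
  finally have "2 * \<i> * cis (- x) * (of_real (real m * sin x) * power_average m (cis (- 2 * x))) =
      2 * \<i> * cis (- x) * (of_real (sin (real m * x)) * cis (- ((real m + 1) * x)))"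
    by (simp add: mult_ac)
  then show ?thesis by simp
qed

lemma x_cos_le_sin:
  fixes x :: real
  assumes "0 \<le> x" "x \<le> pi"
  shows "x * cos x \<le> sin x"
proof -
  have "sin 0 - 0 * cos 0 \<le> sin x - x * cos x"
  proof (rule DERIV_nonneg_imp_nondecreasing [OF assms(1)])
    fix u assume "0 \<le> u" "u \<le> x"
    then show "\<exists>d. ((\<lambda>x. sin x - x * cos x) has_real_derivative d) (at u) \<and> 0 \<le> d"
      using assms(2) by (intro exI [of _ "u * sin u"])
        (auto intro!: derivative_eq_intros mult_nonneg_nonneg sin_ge_zero)
  qed
  then show ?thesis by simp
qed

text \<open>With \<phi> = (m + 1) x this bounds the modulus sin(mx)/(m sin x) of g on the circle
  from below by sin \<phi> / \<phi>. The addition formula splits the left side into two summands,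
  bounded by m x sin(mx) and x sin(mx).\<close>

lemma sin_quotient_le:
  assumes "0 < x" "(real m + 1) * x < pi"
  shows "real m * sin x * sin ((real m + 1) * x) \<le> (real m + 1) * x * sin (real m * x)"
proof -
  have mx: "0 \<le> real m * x" using assms(1) by simp
  moreover have "(real m + 1) * x = real m * x + x" by (simp add: algebra_simps)
  ultimately have mx_pi: "real m * x \<le> pi" and x: "x < pi" using assms by linarith+
  have sx: "0 \<le> sin x" "sin x \<le> x" using assms x by (auto intro: sin_ge_zero sin_x_le_x)
  have smx: "0 \<le> sin (real m * x)" using mx mx_pi by (rule sin_ge_zero)
  have "sin x * cos x \<le> x"
    using mult_mono [OF sx(2) cos_le_one] sx assms(1) by (metis mult_left_le mult.right_neutral order.trans cos_le_one)
  then have 1: "real m * (sin x * cos x) * sin (real m * x) \<le> real m * x * sin (real m * x)"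
    using smx by (intro mult_right_mono mult_left_mono) auto
  \<comment> \<open>For positive cosine, two steps suffice: sin x \<le> x, then u cos u \<le> sin u
    at u = m x.\<close>
  have 2: "real m * cos (real m * x) * (sin x)\<^sup>2 \<le> x * sin (real m * x)"
  proof (cases "cos (real m * x) \<le> 0")
    case True
    then have "real m * cos (real m * x) * (sin x)\<^sup>2 \<le> 0"
      by (simp add: mult_nonneg_nonpos mult_nonpos_nonneg)
    then show ?thesis using smx assms(1) by (meson mult_nonneg_nonneg less_imp_le order.trans)
  next
    case False
    then have "real m * cos (real m * x) * (sin x)\<^sup>2 \<le> real m * cos (real m * x) * x\<^sup>2"
      using sx by (intro mult_left_mono power_mono) auto
    also have "\<dots> = x * (real m * x * cos (real m * x))" by (simp add: power2_eq_square)
    also have "\<dots> \<le> x * sin (real m * x)"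
      using x_cos_le_sin [OF mx mx_pi] assms(1) by (intro mult_left_mono) auto
    finally show ?thesis .
  qed
  have "sin ((real m + 1) * x) = sin (real m * x) * cos x + cos (real m * x) * sin x"
    by (simp add: ring_distribs sin_add)
  then show ?thesis using 1 2 by (simp add: algebra_simps power2_eq_square)
qed

section \<open>Membership in polar coordinates\<close>

text \<open>At x = \<phi> / (m + 1) the phase of g cancels that of a, so a g takes a real value q
  there. The hypothesis and \<open>sin_quotient_le\<close> give q \<ge> 1, and star-shapedness
  scales q down to 1.\<close>

lemma not_mem_MARS_at_polar:
  assumes "m \<ge> 1" "0 < \<phi>" "\<phi> < pi" "\<phi> \<le> t * sin \<phi>"
  shows "of_real t * cis \<phi> \<notin> MARS_at m"
proof -
  define x where "x = \<phi> / (real m + 1)"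
  have x: "(real m + 1) * x = \<phi>" "0 < x" using assms by (auto simp: x_def)
  have mx: "0 < real m * x" "real m * x < pi" "x < pi"
  proof -
    show "0 < real m * x" using x(2) assms(1) by simp
    moreover have "(real m + 1) * x = real m * x + x" by (simp add: algebra_simps)
    ultimately show "real m * x < pi" "x < pi" using x assms(3) by linarith+
  qed
  have s: "0 < sin x" "0 < sin (real m * x)" "0 < sin \<phi>"
    using mx x assms by (auto intro: sin_gt_zero)
  have t: "0 < t" using assms s(3) by (meson less_le_trans zero_less_mult_pos2)
  define q where "q = t * sin (real m * x) / (real m * sin x)"
  have "(real m * sin x) * \<phi> \<le> (real m * sin x) * (t * sin \<phi>)"
    using assms s by (intro mult_left_mono) auto
  also have "\<dots> = t * (real m * sin x * sin \<phi>)" by (simp add: mult_ac)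
  also have "\<dots> \<le> t * (\<phi> * sin (real m * x))"
    using sin_quotient_le [of x m] x(2) assms(3) t unfolding x(1) by (intro mult_left_mono) auto
  finally have "q \<ge> 1"
    using assms s by (simp add: q_def field_simps)
  have "of_real (real m * sin x) * (of_real t * cis \<phi> * power_average m (cis (- 2 * x)))
      = of_real t * cis \<phi> * (of_real (sin (real m * x)) * cis (- \<phi>))"
    using power_average_cis [OF assms(1), of x] x(1) by (simp add: mult_ac)
  also have "\<dots> = of_real (t * sin (real m * x))"
    by (simp add: mult_ac cis_mult)
  finally have prod: "of_real t * cis \<phi> * power_average m (cis (- 2 * x)) = of_real q"
    using s assms by (simp add: q_def field_simps)
  obtain z where z: "norm z \<le> 1" "power_average m z = of_real (1 / q) * power_average m (cis (- 2 * x))"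
    using power_average_starlike [OF assms(1), of "cis (- 2 * x)" "1 / q"] \<open>q \<ge> 1\<close> by auto
  have "of_real t * cis \<phi> * power_average m z
      = of_real (1 / q) * (of_real t * cis \<phi> * power_average m (cis (- 2 * x)))"
    unfolding z(2) by (simp add: mult_ac)
  also have "\<dots> = 1" unfolding prod using \<open>q \<ge> 1\<close> by simp
  finally show ?thesis using z(1) mem_MARS_at_iff [OF assms(1)] by blast
qed

text \<open>A solution of a g = 1 in the disc is pushed out to a point z = exp(-2ix) of the circle
  with a g(z) = r \<ge> 1. For large m this forces y = |x| to be small, while the phase condition
  forces (m + 1) y \<ge> \<phi>; the resulting bounds on m sin y are incompatible.\<close>

lemma mem_MARS_polar:
  assumes "0 \<le> t" "0 < \<phi>" "\<phi> \<le> pi" "t * sin \<phi> < \<phi>"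
  shows "of_real t * cis \<phi> \<in> MARS"
proof -
  \<comment> \<open>The gap between the lower bound (\<phi> - y) cos y and the upper bound t (sin
    \<phi> + y) for m sin y derived below; at y = 0 it is \<phi> - t sin \<phi> > 0.\<close>
  define F where "F y = (\<phi> - y) * cos y - t * (sin \<phi> + y)" for y :: real
  have sphi: "0 \<le> sin \<phi>" using assms by (intro sin_ge_zero) auto
  have "continuous (at 0) F" unfolding F_def by (intro continuous_intros)
  moreover have "F 0 > 0" using assms by (simp add: F_def)
  ultimately have "eventually (\<lambda>y. F y > 0) (nhds 0)"
    by (auto simp: continuous_at tendsto_at_iff_tendsto_nhds dest: order_tendstoD)
  then obtain d where d: "d > 0" "\<And>y. \<bar>y\<bar> < d \<Longrightarrow> F y > 0"
    by (auto simp: eventually_nhds_metric dist_real_def)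
  \<comment> \<open>The cap pi/2 keeps the sine monotone on the range where y and \<delta> are
    compared.\<close>
  define \<delta> where "\<delta> = min d (pi / 2)"
  have \<delta>: "0 < \<delta>" "\<delta> \<le> d" "\<delta> \<le> pi / 2" using d by (auto simp: \<delta>_def)
  have "0 < sin \<delta>" using \<delta> by (intro sin_gt_zero) auto
  then obtain n :: nat where n: "t < real n * sin \<delta>"
    using reals_Archimedean3 by blast
  define m where "m = max 1 n"
  have m: "m \<ge> 1" "t < real m * sin \<delta>"
    using n \<open>0 < sin \<delta>\<close> by (auto simp: m_def max_def elim!: less_le_trans)
  have "of_real t * cis \<phi> \<in> MARS_at m"
    unfolding mem_MARS_at_iff [OF m(1)]
  proof (intro allI impI notI)
    fix z0 :: complex
    assume z0: "norm z0 \<le> 1" "of_real t * cis \<phi> * power_average m z0 = 1"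
    then have "power_average m z0 \<noteq> 0" by auto
    then obtain z r where z: "norm z = 1" "r \<ge> 1" "power_average m z = of_real r * power_average m z0"
      using power_average_reaches_circle [OF m(1) z0(1)] by metis
    have eq: "of_real t * cis \<phi> * power_average m z = of_real r"
      using z(3) z0(2) by (simp add: mult_ac)
    define x where "x = - Arg z / 2"
    have zx: "z = cis (- 2 * x)"
    proof -
      have "sgn z = z" "z \<noteq> 0" using z(1) by (auto simp: sgn_div_norm)
      then show ?thesis by (simp add: x_def cis_Arg)
    qed
    have "\<bar>x\<bar> \<le> pi / 2" using Arg_bounded [of z] by (auto simp: x_def)
    \<comment> \<open>For x = 0 the number a itself would be real and at least 1, whereas \<phi> in
      (0, pi] allows only negative or zero real values.\<close>
    have "x \<noteq> 0"
    proof
      assume "x = 0"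
      then have "of_real t * cis \<phi> = of_real r"
        using eq zx power_average_1 [OF m(1)] by simp
      then have "t * sin \<phi> = 0" "t * cos \<phi> = r" by (auto simp: complex_eq_iff)
      then have "sin \<phi> = 0" using z(2) by auto
      then have "\<phi> = pi" using assms by (metis less_le sin_gt_zero less_irrefl)
      with \<open>t * cos \<phi> = r\<close> assms(1) z(2) show False by simp
    qed
    \<comment> \<open>Up to the sign of the real factors, \<psi> is the phase of a g(z); as this
      product is real and nonzero, sin \<psi> = 0.\<close>
    define \<psi> where "\<psi> = \<phi> - (real m + 1) * x"
    have "of_real (real m * sin x) * of_real r
        = of_real t * cis \<phi> * (of_real (sin (real m * x)) * cis (- ((real m + 1) * x)))"
      using power_average_cis [OF m(1), of x] eq zx by (metis mult.left_commute)
    also have "\<dots> = of_real (t * sin (real m * x)) * (cis \<phi> * cis (- ((real m + 1) * x)))"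
      by simp
    also have "cis \<phi> * cis (- ((real m + 1) * x)) = cis \<psi>"
      by (simp add: cis_mult \<psi>_def)
    finally have re: "real m * sin x * r = t * sin (real m * x) * cos \<psi>"
      and im: "t * sin (real m * x) * sin \<psi> = 0"
      by (auto simp: complex_eq_iff)
    define y where "y = \<bar>x\<bar>"
    have y: "0 < y" "y \<le> pi / 2" using \<open>x \<noteq> 0\<close> \<open>\<bar>x\<bar> \<le> pi / 2\<close> by (auto simp: y_def)
    have "0 < sin y" using y by (intro sin_gt_zero) auto
    moreover have "sin y = sin x \<or> sin y = - sin x" by (auto simp: y_def abs_if)
    ultimately have sy: "0 < sin y" "\<bar>sin x\<bar> = sin y" by auto
    have "t * sin (real m * x) \<noteq> 0" using re sy z(2) m(1) by auto
    with im have "sin \<psi> = 0" by simp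
    have "real m * sin y * 1 \<le> real m * sin y * r" using z(2) sy by (intro mult_left_mono) auto
    also have "\<dots> = \<bar>real m * sin x * r\<bar>" using sy z(2) by (simp add: abs_mult)
    also have "\<dots> = t * \<bar>sin (real m * x)\<bar> * \<bar>cos \<psi>\<bar>"
      unfolding re using assms(1) by (simp add: abs_mult)
    also have "\<dots> \<le> t * \<bar>sin (real m * x)\<bar>"
      using assms(1) by (intro mult_left_le) auto
    finally have msin: "real m * sin y \<le> t * \<bar>sin (real m * x)\<bar>" by simp
    also have "\<dots> \<le> t" using assms(1) by (intro mult_left_le) auto
    finally have "real m * sin y < real m * sin \<delta>" using m(2) by simp
    then have "sin y < sin \<delta>" using m(1) by simp
    have "y < \<delta>"
    proof (rule ccontr)
      assume "\<not> y < \<delta>"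
      then have "sin \<delta> \<le> sin y" using \<delta> y by (intro sin_monotone_2pi_le) auto
      with \<open>sin y < sin \<delta>\<close> show False by simp
    qed
    \<comment> \<open>Otherwise \<psi> lies strictly between 0 and 2 pi, so \<psi> = pi and x < 0.
      Then the real part equates the positive m r sin y with -t sin(my), which is at most 0.\<close>
    have "\<phi> \<le> (real m + 1) * y"
    proof (rule ccontr)
      assume *: "\<not> \<phi> \<le> (real m + 1) * y"
      have "(real m + 1) * y = \<bar>(real m + 1) * x\<bar>" by (simp add: y_def abs_mult)
      with * have "0 < \<psi>" "\<psi> < 2 * pi" using assms by (auto simp: \<psi>_def)
      with \<open>sin \<psi> = 0\<close> have "\<psi> = pi"
        by (metis less_irrefl linorder_neqE_linordered_idom sin_gt_zero sin_lt_zero)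
      then have "(real m + 1) * x \<le> 0" using assms by (simp add: \<psi>_def)
      then have "x \<le> 0" by (simp add: mult_le_0_iff)
      then have "x = - y" by (simp add: y_def)
      then have "real m * sin y * r = - (t * sin (real m * y))"
        using re \<open>\<psi> = pi\<close> by simp
      moreover have "real m * y \<le> (real m + 1) * y" using y by simp
      then have "real m * y \<le> pi" using * assms(3) by linarith
      then have "0 \<le> sin (real m * y)" using y by (intro sin_ge_zero) auto
      then have "0 \<le> t * sin (real m * y)" using assms(1) by simp
      moreover have "0 < real m * sin y * r" using sy m(1) z(2) by simp
      ultimately show False by linarith
    qed
    then have "(\<phi> - y) * cos y \<le> real m * y * cos y"
      using y by (intro mult_right_mono cos_ge_zero) (auto simp: algebra_simps)
    also have "\<dots> \<le> real m * sin y"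
      using x_cos_le_sin [of y] y by (simp add: mult.assoc mult_left_mono)
    also have "\<dots> \<le> t * (sin \<phi> + y)"
    proof -
      \<comment> \<open>Writing m x = (\<phi> - \<psi>) - x and using sin \<psi> = 0 brings in sin
        \<phi>, with an error of at most |sin x| \<le> y.\<close>
      have "sin (real m * x) = sin ((\<phi> - \<psi>) - x)" by (simp add: \<psi>_def algebra_simps)
      also have "\<dots> = sin \<phi> * cos \<psi> * cos x - cos (\<phi> - \<psi>) * sin x"
        using \<open>sin \<psi> = 0\<close> by (simp add: sin_diff)
      finally have "\<bar>sin (real m * x)\<bar> \<le> \<bar>sin \<phi> * cos \<psi> * cos x\<bar> + \<bar>cos (\<phi> - \<psi>) * sin x\<bar>"
        by (simp only: abs_triangle_ineq4)
      also have "\<bar>sin \<phi> * cos \<psi> * cos x\<bar> \<le> sin \<phi>"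
        using sphi by (simp add: abs_mult mult_left_le mult_le_one mult.assoc)
      also have "\<bar>cos (\<phi> - \<psi>) * sin x\<bar> \<le> \<bar>sin x\<bar>"
        by (simp add: abs_mult mult_left_le_one_le)
      also have "\<bar>sin x\<bar> \<le> y" unfolding y_def by (rule abs_sin_x_le_abs_x)
      finally have "t * \<bar>sin (real m * x)\<bar> \<le> t * (sin \<phi> + y)"
        using assms(1) by (intro mult_left_mono) auto
      with msin show ?thesis by simp
    qed
    finally have "F y \<le> 0" by (simp add: F_def)
    moreover have "F y > 0" using d(2) [of y] \<open>y < \<delta>\<close> \<delta> y by simp
    ultimately show False by simp
  qed
  with m(1) show ?thesis by (auto simp: MARS_def)
qed

section \<open>From polar to Cartesian coordinates\<close>

lemma arccot_cot:
  assumes "0 < y" "y < pi"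
  shows "arccot (cot y) = y"
proof -
  have "arctan (tan (pi / 2 - y)) = pi / 2 - y" using assms by (intro arctan_tan) auto
  moreover have "tan (pi / 2 - y) = cot y" by (simp add: tan_def cot_def cos_diff sin_diff)
  ultimately show ?thesis by (simp add: arccot_eq)
qed

lemma less_arccot_iff:
  assumes "0 < \<eta>"
  shows "\<eta> < arccot (\<xi> / \<eta>) \<longleftrightarrow> \<eta> < pi \<and> \<xi> < \<eta> * cot \<eta>"
proof (cases "\<eta> < pi")
  case True
  have "arccot x < arccot y \<longleftrightarrow> y < x" for x y
    by (metis arccot_strict_antimono less_asym linorder_neqE_linordered_idom)
  from this [of "cot \<eta>" "\<xi> / \<eta>"] show ?thesis
    using True assms by (simp add: arccot_cot field_simps)
next
  case False
  with arccot_bounds(2) [of "\<xi> / \<eta>"] show ?thesis by simp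
qed

lemma Arg_eq_arccot:
  assumes "0 < Im a"
  shows "Arg a = arccot (Re a / Im a)"
proof -
  have "a \<noteq> 0" using assms by auto
  then have a: "Re a = norm a * cos (Arg a)" "Im a = norm a * sin (Arg a)"
    using rcis_cmod_Arg [of a] by (metis Re_rcis, metis Im_rcis)
  have "Re a / Im a = cot (Arg a)"
    using \<open>a \<noteq> 0\<close> by (subst a(1), subst a(2)) (simp add: cot_def)
  with assms show ?thesis using Arg_lt_pi [of a] by (simp add: arccot_cot)
qed

text \<open>For t = |a| and \<phi> = Arg a the number t sin \<phi> is Im a, so the polar criterion
  reads Im a < Arg a, and Arg a is the inverse cotangent of Re a / Im a.\<close>

lemma mem_MARS_iff_Im_pos:
  assumes "0 < Im a"
  shows "a \<in> MARS \<longleftrightarrow> Im a < pi \<and> Re a < Im a * cot (Im a)"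
proof -
  have Arg: "0 < Arg a" "Arg a < pi" using assms Arg_lt_pi [of a] by auto
  have a: "a = of_real (norm a) * cis (Arg a)"
    using rcis_cmod_Arg [of a] by (simp add: rcis_def)
  then have Im: "Im a = norm a * sin (Arg a)" by (metis Im_rcis rcis_def)
  have "a \<in> MARS \<longleftrightarrow> Im a < Arg a"
  proof
    assume "a \<in> MARS"
    then obtain m where "m \<ge> 1" "a \<in> MARS_at m" by (auto simp: MARS_def)
    with not_mem_MARS_at_polar [OF _ Arg, of m "norm a"] a Im show "Im a < Arg a"
      by (metis not_le)
  next
    assume "Im a < Arg a"
    then have "of_real (norm a) * cis (Arg a) \<in> MARS"
      using Arg Im by (intro mem_MARS_polar) auto
    with a show "a \<in> MARS" by simp
  qed
  with assms show ?thesis by (simp add: Arg_eq_arccot less_arccot_iff)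
qed

section \<open>The real axis, the lower half-plane and the final formulas\<close>

text \<open>For x \<ge> 1, the value g(1) = 1 can be shrunk to 1/x. Negative x is the polar case
  \<phi> = pi, and for 0 \<le> x < 1 already m = 1 works because |g| \<le> 1.\<close>

lemma mem_MARS_of_real_iff: "of_real x \<in> MARS \<longleftrightarrow> x < 1"
proof
  assume "of_real x \<in> MARS"
  then obtain m where m: "m \<ge> 1" "of_real x \<in> MARS_at m" by (auto simp: MARS_def)
  show "x < 1"
  proof (rule ccontr)
    assume "\<not> x < 1"
    then obtain z where "norm z \<le> 1" "power_average m z = of_real (1 / x) * power_average m 1"
      using power_average_starlike [OF m(1), of 1 "1 / x"] by auto
    with m \<open>\<not> x < 1\<close> mem_MARS_at_iff [OF m(1)] power_average_1 [OF m(1)] show False by auto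
  qed
next
  assume "x < 1"
  show "of_real x \<in> MARS"
  proof (cases "x < 0")
    case True
    then have "of_real (- x) * cis pi \<in> MARS" by (intro mem_MARS_polar) auto
    then show ?thesis by simp
  next
    case False
    have "of_real x \<in> MARS_at 1"
    proof (subst mem_MARS_at_iff, simp, intro allI impI notI)
      fix z :: complex assume z: "norm z \<le> 1" "of_real x * power_average 1 z = 1"
      have "x * norm (power_average 1 z) = norm (of_real x * power_average 1 z)"
        using False by (simp only: norm_mult norm_of_real abs_of_nonneg not_less)
      also have "\<dots> = 1" unfolding z(2) by simp
      finally have "x * norm (power_average 1 z) = 1" .
      moreover have "x * norm (power_average 1 z) \<le> x"
        using False norm_power_average_le [OF z(1)] by (intro mult_left_le) auto
      ultimately show False using \<open>x < 1\<close> by simp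
    qed
    then show ?thesis by (auto simp: MARS_def)
  qed
qed

text \<open>The polynomial g has real coefficients, so conjugation carries solutions of a g(z) = 1
  to solutions for \<open>cnj a\<close>.\<close>

lemma cnj_mem_MARS_iff: "cnj a \<in> MARS \<longleftrightarrow> a \<in> MARS"
proof -
  have imp: "cnj a \<in> MARS" if a: "a \<in> MARS" for a
  proof -
    obtain m where m: "m \<ge> 1" "a \<in> MARS_at m" using a by (auto simp: MARS_def)
    have "cnj a * power_average m z \<noteq> 1" if "norm z \<le> 1" for z
    proof
      assume "cnj a * power_average m z = 1"
      then have "cnj (cnj a * power_average m z) = 1" by simp
      then have "a * power_average m (cnj z) = 1" by (simp add: cnj_power_average)
      moreover have "norm (cnj z) \<le> 1" using that by simp
      ultimately show False using m mem_MARS_at_iff [OF m(1)] by blast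
    qed
    with m(1) have "cnj a \<in> MARS_at m" by (simp add: mem_MARS_at_iff)
    with m(1) show ?thesis by (auto simp: MARS_def)
  qed
  from imp [of a] imp [of "cnj a"] show ?thesis by auto
qed

lemma mem_MARS_iff:
  "a \<in> MARS \<longleftrightarrow> Im a \<in> {-pi<..<0} \<union> {0<..<pi} \<and> Re a < Im a * cot (Im a) \<or> Im a = 0 \<and> Re a < 1"
proof (cases "Im a" "0 :: real" rule: linorder_cases)
  case less
  then show ?thesis
    \<comment> \<open>The function \<eta> cot \<eta> is even, so the condition keeps its form under
      conjugation.\<close>
    using mem_MARS_iff_Im_pos [of "cnj a"] cnj_mem_MARS_iff [of a] by (auto simp: cot_def)
next
  case equal
  then have "a = of_real (Re a)" by (simp add: complex_eq_iff)
  with equal mem_MARS_of_real_iff [of "Re a"] show ?thesis by auto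
next
  case greater
  then show ?thesis using mem_MARS_iff_Im_pos [of a] by auto
qed

theorem corollary9p4:
  shows "(MARS_plus = {complex_of_real \<xi> + \<i> * complex_of_real \<eta> | \<xi> \<eta> :: real.
            0 < \<eta> \<and> \<eta> < arccot (\<xi> / \<eta>)} \<and>
          {complex_of_real \<xi> + \<i> * complex_of_real \<eta> | \<xi> \<eta> :: real.
            0 < \<eta> \<and> \<eta> < arccot (\<xi> / \<eta>)}
          = {a :: complex. Im a \<in> {0<..<pi} \<and> Im (exp a * cnj a) < 0}) \<and>
         MARS = {complex_of_real \<xi> + \<i> * complex_of_real \<eta> | \<xi> \<eta> :: real.
            \<xi> < \<eta> * cot \<eta> \<and> \<eta> \<in> {-pi<..<0} \<union> {0<..<pi}}
         \<union> complex_of_real ` {..<1}"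
proof -
  have coords: "{complex_of_real \<xi> + \<i> * complex_of_real \<eta> | \<xi> \<eta>. P \<xi> \<eta>} = {a. P (Re a) (Im a)}"
    for P by (auto simp: complex_eq_iff)
  have real: "complex_of_real ` {..<1} = {a. Im a = 0 \<and> Re a < 1}"
    by (auto simp: complex_eq_iff image_iff)
  have plus: "MARS_plus = {a. 0 < Im a \<and> a \<in> MARS}"
    by (auto simp: MARS_plus_def MARS_at_plus_def MARS_def)
  have expo: "Im (exp a * cnj a) < 0 \<longleftrightarrow> Re a < Im a * cot (Im a)"
    if "0 < Im a" "Im a < pi" for a
  proof -
    \<comment> \<open>Dividing the bracket by sin (Im a) > 0 yields the cotangent condition.\<close>
    have eq: "Im (exp a * cnj a) = exp (Re a) * (Re a * sin (Im a) - Im a * cos (Im a))"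
      by (simp add: Re_exp Im_exp right_diff_distrib mult_ac)
    have "0 < sin (Im a)" using that by (rule sin_gt_zero)
    then show ?thesis unfolding eq by (simp add: mult_less_0_iff cot_def field_simps)
  qed
  then have third: "{a. Im a \<in> {0<..<pi} \<and> Im (exp a * cnj a) < 0}
      = {a. 0 < Im a \<and> Im a < pi \<and> Re a < Im a * cot (Im a)}"
    unfolding greaterThanLessThan_iff by blast
  show ?thesis
    unfolding coords real plus third by (auto simp: less_arccot_iff mem_MARS_iff)
qed

end
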